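(* Let $\pi$ be a deterministic Markov policy for the approximate MDP $\hat M$, i.e. $\pi_h(s,\hat b)\in\mathcal A_h(s)\times\hat{\mathcal B}^S$. For all $h\in[H+1]$, $s\in\mathcal S$ and $\hat b\in\hat{\mathcal B}$: if $\hat V^\pi_h(s,\hat b)>-\infty$, then $\hat C^\pi_h(s,\hat b)\le\hat b+\ell(S+1)(H-h+1)$.
   Context: Cost-accumulating MDP. Fix $H,m\in\mathbb N$. A finite-horizon tabular cost-accumulating MDP consists of: - states $\mathcal S=\{1,\dots,S\}$; - finite action sets $\mathcal A_h(s)$; - transitions $P_h(\cdot\mid s,a)$; - expected rewards $r_h(s,a)$; - deterministic costs $c_h(s,a)\in\mathbb R^m$. Vector inequalities are componentwise, and scalars added to vectors are added to each coordinate. SR functions. Let $f:\mathbb R^m\times\mathbb R^m\to\mathbb R^m$ satisfy: - $f$ is associative; - $f$ is componentwise non-decreasing in each argument; - $f$ is $1$-Lipschitz in each argument for $\|\cdot\|_\infty$; - $f(0,x)=f(x,0)=x$. Let $g:[0,1]\to[0,1]$ satisfy $g(0)=0$. Write $f_{s'}y_{s'}=f(y_1,f(y_2,\dots,y_S))$. Assume $x\mapsto f_{s'}g(p_{s'})x_{s'}$ is $1$-Lipschitz for $\|\cdot\|_\infty$ for every probability vector $p$. Approximate MDP $\hat M$ with parameter $\ell>0$. - Rounding is $\lceil x\rceil_\ell=\lceil x/\ell\rceil\ell$ componentwise, and $\kappa(x)=x+\ell(S+1)$. - $\hat{\mathcal B}=\{\lceil b\rceil_\ell:b\in[b_{\min},b_{\max}]\}$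 for fixed $b_{\min}\le b_{\max}$ in $\mathbb R^m$. - For $\hat{\mathbf b}\in\hat{\mathcal B}^S$ let $\hat f^{s,a}_{h,\hat{\mathbf b}}(S+1,F)=F$ and $\hat f^{s,a}_{h,\hat{\mathbf b}}(t,F)=\hat f^{s,a}_{h,\hat{\mathbf b}}(t+1,\lceil f(F,g(P_h(t\mid s,a))\hat b_t)\rceil_\ell)$. - The allowed actions at $(s,\hat b)$ are $\hat{\mathcal A}_h(s,\hat b)=\{(a,\hat{\mathbf b})\in\mathcal A_h(s)\times\hat{\mathcal B}^S:c_h(s,a)+\hat f^{s,a}_{h,\hat{\mathbf b}}(1,0)\le\kappa(\hat b)\}$. - Playing $(a,\hat{\mathbf b})$ gives reward $r_h(s,a)$ and moves to $(s',\hat b_{s'})$ with $s'\sim P_h(\cdot\mid s,a)$. Value of $\pi$ in $\hat M$. $\hat V^\pi_{H+1}(s,\hat b)=0$ if $\hat b\ge0$ and $-\infty$ otherwise. For $h\le H$ with $(a,\hat{\mathbf b})=\pi_h(s,\hat b)$: - $\hat V^\pi_h(s,\hat b)=-\infty$ if $(a,\hat{\mathbf b})\notin\hat{\mathcal A}_h(s,\hat b)$; - otherwise $\hat V^\pi_h(s,\hat b)=r_h(s,a)+\sum_{s':P_h(s'|s,a)>0}P_h(s'\mid s,a)\hat V^\pi_{h+1}(s',\hat b_{s'})$. Cost of $\pi$ in $\hat M$. $\hat C^\pi_{H+1}\equiv0$ and $\hat C^\pi_h(s,\hat b)=c_h(s,a)+f_{s'}g(P_h(s'\mid s,a))\hat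 C^\pi_{h+1}(s',\hat b_{s'})$. *)

theory Defs
  imports "HOL-Analysis.Analysis"
begin

text \<open>Stages are numbered from 1 to the horizon and states from 1 to the number of states.
  The space of costs and budgets is \<^typ>\<open>real ^ 'm\<close> with its componentwise order; adding a
  scalar to every coordinate of a vector is written as adding \<^term>\<open>vec c\<close>.\<close>

record ('a, 'm::finite) cost_mdp =
  horizon :: nat
  num_states :: nat
  actions :: "nat \<Rightarrow> nat \<Rightarrow> 'a set"
  trans_prob :: "nat \<Rightarrow> nat \<Rightarrow> 'a \<Rightarrow> nat \<Rightarrow> real"
  reward :: "nat \<Rightarrow> nat \<Rightarrow> 'a \<Rightarrow> real"
  cost :: "nat \<Rightarrow> nat \<Rightarrow> 'a \<Rightarrow> real ^ 'm"

definition states :: "('a, 'm::finite) cost_mdp \<Rightarrow> nat set" where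
  "states M = {1..num_states M}"

definition prob_vector :: "nat \<Rightarrow> (nat \<Rightarrow> real) \<Rightarrow> bool" where
  "prob_vector n p \<longleftrightarrow> (\<forall>s\<in>{1..n}. 0 \<le> p s) \<and> (\<Sum>s\<in>{1..n}. p s) = 1"

definition is_cost_mdp :: "('a, 'm::finite) cost_mdp \<Rightarrow> bool" where
  "is_cost_mdp M \<longleftrightarrow>
     (\<forall>h\<in>{1..horizon M}. \<forall>s\<in>states M. finite (actions M h s) \<and>
        (\<forall>a\<in>actions M h s. prob_vector (num_states M) (trans_prob M h s a)))"

text \<open>The nested application \<open>f y\<^sub>1 (f y\<^sub>2 (\<dots> y\<^sub>n))\<close>; the value on the empty list is never used
  for a nonempty state space.\<close>

fun nest :: "('v::zero \<Rightarrow> 'v \<Rightarrow> 'v) \<Rightarrow> 'v list \<Rightarrow> 'v" where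
  "nest f [] = 0"
| "nest f [y] = y"
| "nest f (y # z # ys) = f y (nest f (z # ys))"

definition nest_states :: "('v::zero \<Rightarrow> 'v \<Rightarrow> 'v) \<Rightarrow> nat \<Rightarrow> (nat \<Rightarrow> 'v) \<Rightarrow> 'v" where
  "nest_states f n y = nest f (map y [1..<Suc n])"

definition sr_functions ::
  "nat \<Rightarrow> (real ^ 'm::finite \<Rightarrow> real ^ 'm \<Rightarrow> real ^ 'm) \<Rightarrow> (real \<Rightarrow> real) \<Rightarrow> bool" where
  "sr_functions n f g \<longleftrightarrow>
     (\<forall>x y z. f (f x y) z = f x (f y z)) \<and>
     (\<forall>x y z. x \<le> y \<longrightarrow> f x z \<le> f y z \<and> f z x \<le> f z y) \<and>
     (\<forall>x y z. infnorm (f x z - f y z) \<le> infnorm (x - y) \<and>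
              infnorm (f z x - f z y) \<le> infnorm (x - y)) \<and>
     (\<forall>x. f 0 x = x \<and> f x 0 = x) \<and>
     (\<forall>p\<in>{0..1}. g p \<in> {0..1}) \<and> g 0 = 0 \<and>
     (\<forall>p. prob_vector n p \<longrightarrow>
        (\<forall>x y. infnorm (nest_states f n (\<lambda>s. g (p s) *\<^sub>R x s) -
                        nest_states f n (\<lambda>s. g (p s) *\<^sub>R y s))
               \<le> Max ((\<lambda>s. infnorm (x s - y s)) ` {1..n})))"

definition round_up :: "real \<Rightarrow> real ^ 'm::finite \<Rightarrow> real ^ 'm" where
  "round_up l x = (\<chi> i. of_int \<lceil>x $ i / l\<rceil> * l)"

definition kappa :: "nat \<Rightarrow> real \<Rightarrow> real ^ 'm::finite \<Rightarrow> real ^ 'm" where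
  "kappa n l x = x + vec (l * (real n + 1))"

definition budgets :: "real \<Rightarrow> real ^ 'm::finite \<Rightarrow> real ^ 'm \<Rightarrow> (real ^ 'm) set" where
  "budgets l bmin bmax = round_up l ` {bmin..bmax}"

text \<open>The budget vectors, indexed by the states, are the extensional functions on the state set.\<close>

definition budget_vectors ::
  "nat \<Rightarrow> real \<Rightarrow> real ^ 'm::finite \<Rightarrow> real ^ 'm \<Rightarrow> (nat \<Rightarrow> real ^ 'm) set" where
  "budget_vectors n l bmin bmax = {1..n} \<rightarrow>\<^sub>E budgets l bmin bmax"

text \<open>Here \<open>p\<close> is the transition vector of the stage, state and action in question.\<close>

function fhat :: "nat \<Rightarrow> (real ^ 'm::finite \<Rightarrow> real ^ 'm \<Rightarrow> real ^ 'm) \<Rightarrow> (real \<Rightarrow> real) \<Rightarrow> real \<Rightarrow>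
    (nat \<Rightarrow> real) \<Rightarrow> (nat \<Rightarrow> real ^ 'm) \<Rightarrow> nat \<Rightarrow> real ^ 'm \<Rightarrow> real ^ 'm" where
  "fhat n f g l p bs t F =
     (if t > n then F
      else fhat n f g l p bs (t + 1) (round_up l (f F (g (p t) *\<^sub>R bs t))))"
  by auto
termination by (relation "Wellfounded.measure (\<lambda>(n, f, g, l, p, bs, t, F). Suc n - t)") auto

declare fhat.simps [simp del]

definition approx_actions ::
  "('a, 'm::finite) cost_mdp \<Rightarrow> (real ^ 'm \<Rightarrow> real ^ 'm \<Rightarrow> real ^ 'm) \<Rightarrow> (real \<Rightarrow> real) \<Rightarrow> real \<Rightarrow>
    real ^ 'm \<Rightarrow> real ^ 'm \<Rightarrow> nat \<Rightarrow> nat \<Rightarrow> real ^ 'm \<Rightarrow> ('a \<times> (nat \<Rightarrow> real ^ 'm)) set" where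
  "approx_actions M f g l bmin bmax h s b =
     {(a, bs). (a, bs) \<in> actions M h s \<times> budget_vectors (num_states M) l bmin bmax \<and>
        cost M h s a + fhat (num_states M) f g l (trans_prob M h s a) bs 1 0
          \<le> kappa (num_states M) l b}"

type_synonym ('a, 'm) approx_policy =
  "nat \<Rightarrow> nat \<Rightarrow> real ^ 'm \<Rightarrow> 'a \<times> (nat \<Rightarrow> real ^ 'm)"

definition is_approx_policy ::
  "('a, 'm::finite) cost_mdp \<Rightarrow> real \<Rightarrow> real ^ 'm \<Rightarrow> real ^ 'm \<Rightarrow> ('a, 'm) approx_policy \<Rightarrow> bool"
  where
  "is_approx_policy M l bmin bmax \<pi> \<longleftrightarrow>
     (\<forall>h\<in>{1..horizon M}. \<forall>s\<in>states M. \<forall>b\<in>budgets l bmin bmax.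
        \<pi> h s b \<in> actions M h s \<times> budget_vectors (num_states M) l bmin bmax)"

text \<open>Values lie in \<^typ>\<open>ereal\<close>. They are never \<open>\<infinity>\<close>, and the sum ranges only over successors of
  positive probability, so it is \<open>-\<infinity>\<close> exactly if one of these successors has value \<open>-\<infinity>\<close>. For
  both the value and the cost, all stages beyond the horizon are treated as the terminal one.\<close>

function approx_value ::
  "('a, 'm::finite) cost_mdp \<Rightarrow> (real ^ 'm \<Rightarrow> real ^ 'm \<Rightarrow> real ^ 'm) \<Rightarrow> (real \<Rightarrow> real) \<Rightarrow> real \<Rightarrow>
    real ^ 'm \<Rightarrow> real ^ 'm \<Rightarrow> ('a, 'm) approx_policy \<Rightarrow> nat \<Rightarrow> nat \<Rightarrow> real ^ 'm \<Rightarrow> ereal" where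
  "approx_value M f g l bmin bmax \<pi> h s b =
     (if h > horizon M then (if b \<ge> 0 then 0 else -\<infinity>)
      else let (a, bs) = \<pi> h s b in
        if (a, bs) \<notin> approx_actions M f g l bmin bmax h s b then -\<infinity>
        else ereal (reward M h s a) +
          (\<Sum>s' | s' \<in> states M \<and> trans_prob M h s a s' > 0.
             ereal (trans_prob M h s a s') * approx_value M f g l bmin bmax \<pi> (h + 1) s' (bs s')))"
  by auto
termination
  by (relation "Wellfounded.measure (\<lambda>(M, f, g, l, bmin, bmax, \<pi>, h, s, b). Suc (horizon M) - h)") auto

declare approx_value.simps [simp del]

function approx_cost ::
  "('a, 'm::finite) cost_mdp \<Rightarrow> (real ^ 'm \<Rightarrow> real ^ 'm \<Rightarrow> real ^ 'm) \<Rightarrow> (real \<Rightarrow> real) \<Rightarrow>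
    ('a, 'm) approx_policy \<Rightarrow> nat \<Rightarrow> nat \<Rightarrow> real ^ 'm \<Rightarrow> real ^ 'm" where
  "approx_cost M f g \<pi> h s b =
     (if h > horizon M then 0
      else let (a, bs) = \<pi> h s b in
        cost M h s a +
          nest_states f (num_states M)
            (\<lambda>s'. g (trans_prob M h s a s') *\<^sub>R approx_cost M f g \<pi> (h + 1) s' (bs s')))"
  by auto
termination
  by (relation "Wellfounded.measure (\<lambda>(M, f, g, \<pi>, h, s, b). Suc (horizon M) - h)") auto

declare approx_cost.simps [simp del]

end

theory Submission imports Defs begin

text \<open>Rounding up only increases its argument, so by monotonicity of \<open>f\<close> the rounded accumulation
  of the budgets dominates the exact one. Hence along an allowed action the budgets, accumulated
  exactly, respect the current budget up to the slack of \<open>\<kappa>\<close>. If the costs-to-go exceed the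
  successor budgets by at most \<open>\<delta>\<close> wherever the transition probability is positive, the joint
  Lipschitz condition makes the accumulated excess at most \<open>\<delta>\<close> (the other successors are
  annihilated by \<open>g 0 = 0\<close>), so the excess grows by at most \<open>l (S + 1)\<close> per stage.\<close>

lemma round_up_ge:
  assumes "l > 0"
  shows "x \<le> round_up l x"
proof -
  have "x $ i \<le> of_int \<lceil>x $ i / l\<rceil> * l" for i
    using assms le_of_int_ceiling[of "x $ i / l"]
    by (simp add: pos_divide_le_eq del: le_of_int_ceiling)
  then show ?thesis
    by (simp add: round_up_def less_eq_vec_def)
qed

text \<open>With a right unit, the value \<open>0\<close> on the empty list acts as a neutral end,
  so the singleton clause becomes an instance of the general one.\<close>

lemma nest_Cons:
  assumes "\<And>x. f x 0 = x"
  shows "nest f (y # ys) = f y (nest f ys)"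
  using assms by (cases ys) auto

lemma nest_map_mono:
  fixes x y :: "'b \<Rightarrow> 'v::{zero, order}"
  assumes right_unit: "\<And>x. f x 0 = x"
    and mono1: "\<And>x y z. x \<le> y \<Longrightarrow> f x z \<le> f y z"
    and mono2: "\<And>x y z. x \<le> y \<Longrightarrow> f z x \<le> f z y"
    and le: "\<And>s. s \<in> set ss \<Longrightarrow> x s \<le> y s"
  shows "nest f (map x ss) \<le> nest f (map y ss)"
  using le
proof (induction ss)
  case (Cons s ss)
  have "f (x s) (nest f (map x ss)) \<le> f (y s) (nest f (map x ss))"
    using Cons.prems by (intro mono1) simp
  also have "\<dots> \<le> f (y s) (nest f (map y ss))"
    using Cons by (intro mono2) simp
  finally show ?case
    by (simp add: nest_Cons right_unit)
qed simp

text \<open>\<open>fhat\<close> folds from the left and \<open>nest\<close> from the right. Keeping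
  the accumulator \<open>F\<close> general lets associativity absorb the head of the list into it,
  where rounding can only increase the result.\<close>

lemma nest_le_fhat:
  assumes assoc: "\<And>x y z. f (f x y) z = f x (f y z)"
    and mono: "\<And>x y z. x \<le> y \<Longrightarrow> f x z \<le> f y z"
    and right_unit: "\<And>x. f x 0 = x"
    and "l > 0" "t \<le> Suc n"
  shows "f F (nest f (map (\<lambda>s. g (p s) *\<^sub>R bs s) [t..<Suc n])) \<le> fhat n f g l p bs t F"
  using \<open>t \<le> Suc n\<close>
proof (induction t arbitrary: F rule: inc_induct)
  case base
  then show ?case
    by (simp add: fhat.simps right_unit)
next
  case (step t)
  let ?y = "\<lambda>s. g (p s) *\<^sub>R bs s"
  let ?N = "nest f (map ?y [Suc t..<Suc n])"
  have "[t..<Suc n] = t # [Suc t..<Suc n]"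
    using step.hyps by (simp add: upt_conv_Cons del: upt_Suc)
  then have "f F (nest f (map ?y [t..<Suc n])) = f (f F (?y t)) ?N"
    by (simp add: nest_Cons right_unit assoc del: upt_Suc)
  also have "\<dots> \<le> f (round_up l (f F (?y t))) ?N"
    by (intro mono round_up_ge \<open>l > 0\<close>)
  also have "\<dots> \<le> fhat n f g l p bs (Suc t) (round_up l (f F (?y t)))"
    by (rule step.IH)
  also have "\<dots> = fhat n f g l p bs t F"
    using step.hyps by (simp add: fhat.simps[of n f g l p bs t])
  finally show ?case .
qed

text \<open>Needed because \<infinity> absorbs -\<infinity> in \<open>ereal\<close> addition: a
  summand \<infinity> would hide a successor of value -\<infinity>.\<close>

lemma approx_value_neq_PInfty: "approx_value M f g l bmin bmax \<pi> h s b \<noteq> \<infinity>"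
proof (induction "Suc (horizon M) - h" arbitrary: h s b)
  case 0
  then show ?case
    by (simp add: approx_value.simps)
next
  case (Suc k)
  have IH: "approx_value M f g l bmin bmax \<pi> (h + 1) s' b' \<noteq> \<infinity>" for s' b'
    using Suc by simp
  obtain a bs where \<pi>: "\<pi> h s b = (a, bs)"
    by fastforce
  have "ereal p * approx_value M f g l bmin bmax \<pi> (h + 1) s' b' \<noteq> \<infinity>" if "p > 0" for p s' b'
    using that IH[of s' b'] by (cases "approx_value M f g l bmin bmax \<pi> (h + 1) s' b'") auto
  then have "(\<Sum>s' | s' \<in> states M \<and> trans_prob M h s a s' > 0.
      ereal (trans_prob M h s a s') * approx_value M f g l bmin bmax \<pi> (h + 1) s' (bs s')) \<noteq> \<infinity>"
    by (auto simp: sum_Pinfty)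
  then show ?case
    by (subst approx_value.simps) (simp add: \<pi>)
qed

lemma approx_value_successor:
  assumes "h \<le> horizon M" "\<pi> h s b = (a, bs)"
    and finite_value: "approx_value M f g l bmin bmax \<pi> h s b > -\<infinity>"
  shows "(a, bs) \<in> approx_actions M f g l bmin bmax h s b"
    and "\<lbrakk>s' \<in> states M; trans_prob M h s a s' > 0\<rbrakk>
      \<Longrightarrow> approx_value M f g l bmin bmax \<pi> (h + 1) s' (bs s') > -\<infinity>"
proof -
  let ?V = "\<lambda>s'. approx_value M f g l bmin bmax \<pi> (h + 1) s' (bs s')"
  let ?p = "trans_prob M h s a"
  let ?T = "{s'. s' \<in> states M \<and> ?p s' > 0}"
  show allowed: "(a, bs) \<in> approx_actions M f g l bmin bmax h s b"
    using assms by (subst (asm) approx_value.simps) (auto split: if_splits)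
  assume s': "s' \<in> states M" "?p s' > 0"
  have "finite ?T"
    by (simp add: states_def)
  have "ereal (?p t) * ?V t \<noteq> \<infinity>" if "t \<in> ?T" for t
    using that approx_value_neq_PInfty[of M f g l bmin bmax \<pi> "h + 1" t "bs t"]
    by (cases "?V t") auto
  then have rest: "(\<Sum>t\<in>?T - {s'}. ereal (?p t) * ?V t) \<noteq> \<infinity>"
    by (auto simp: sum_Pinfty)
  show "?V s' > -\<infinity>"
  proof (rule ccontr)
    assume "\<not> ?V s' > -\<infinity>"
    then have "?V s' = -\<infinity>"
      by simp
    \<comment> \<open>As \<open>?p s' > 0\<close>, the term of \<open>s'\<close> is itself
      -\<infinity>; it decides the sum because the remaining terms do not add up to
      \<infinity>.\<close>
    then have "(\<Sum>t\<in>?T. ereal (?p t) * ?V t) = -\<infinity> + (\<Sum>t\<in>?T - {s'}. ereal (?p t) * ?V t)"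
      using s' \<open>finite ?T\<close> by (subst sum.remove[of _ s']) auto
    also have "\<dots> = -\<infinity>"
      using rest by (cases "\<Sum>t\<in>?T - {s'}. ereal (?p t) * ?V t") auto
    finally have "approx_value M f g l bmin bmax \<pi> h s b = -\<infinity>"
      using assms(1,2) allowed by (subst approx_value.simps) simp
    then show False
      using finite_value by simp
  qed
qed

lemma prob_vector_bounds:
  assumes "prob_vector n p" "s \<in> {1..n}"
  shows "p s \<in> {0..1}"
proof -
  have "p s \<le> (\<Sum>s\<in>{1..n}. p s)"
    using assms by (intro member_le_sum) (auto simp: prob_vector_def)
  then show ?thesis
    using assms by (auto simp: prob_vector_def)
qed

lemma infnorm_vec:
  assumes "0 \<le> c"
  shows "infnorm (vec c :: real ^ 'm::finite) = c"
  using assms by (simp add: infnorm_cart)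

lemma nest_states_le_shift:
  fixes f :: "real ^ 'm::finite \<Rightarrow> real ^ 'm \<Rightarrow> real ^ 'm"
  assumes sr: "sr_functions n f g" and p: "prob_vector n p" and "0 \<le> \<delta>"
    and le: "\<And>s. \<lbrakk>s \<in> {1..n}; p s > 0\<rbrakk> \<Longrightarrow> x s \<le> y s + vec \<delta>"
  shows "nest_states f n (\<lambda>s. g (p s) *\<^sub>R x s) \<le> nest_states f n (\<lambda>s. g (p s) *\<^sub>R y s) + vec \<delta>"
proof -
  let ?G = "\<lambda>x. nest_states f n (\<lambda>s. g (p s) *\<^sub>R x s)"
  \<comment> \<open>The shifted vector is an intermediate point: monotonicity leads from
    \<open>x\<close> to \<open>?z\<close>, and the Lipschitz condition from \<open>?z\<close> to
    \<open>y\<close>, since these differ by exactly \<open>vec \<delta>\<close> at every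
    state.\<close>
  let ?z = "\<lambda>s. y s + vec \<delta>"
  \<comment> \<open>Total mass 1 excludes an empty state set, so the \<open>Max\<close> below is
    over a nonempty set.\<close>
  have "n \<noteq> 0"
    using p by (cases n) (auto simp: prob_vector_def)
  have weighted: "g (p s) *\<^sub>R x s \<le> g (p s) *\<^sub>R ?z s" if "s \<in> {1..n}" for s
  proof (cases "p s > 0")
    case True
    have "0 \<le> g (p s)"
      using sr prob_vector_bounds[OF p that] by (auto simp: sr_functions_def)
    then show ?thesis
      using le[OF that True] by (simp add: less_eq_vec_def mult_left_mono)
  next
    case False
    then have "p s = 0"
      using prob_vector_bounds[OF p that] by auto
    then show ?thesis
      using sr by (simp add: sr_functions_def)
  qed
  have mono: "?G x \<le> ?G ?z"
    unfolding nest_states_def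
    using sr weighted by (intro nest_map_mono) (auto simp: sr_functions_def)
  have "infnorm (?G u - ?G v) \<le> Max ((\<lambda>s. infnorm (u s - v s)) ` {1..n})" for u v
    using sr p unfolding sr_functions_def by blast
  then have "infnorm (?G ?z - ?G y) \<le> Max ((\<lambda>s. infnorm (?z s - y s)) ` {1..n})" .
  also have "\<dots> = \<delta>"
    using \<open>n \<noteq> 0\<close> \<open>0 \<le> \<delta>\<close> by (simp add: infnorm_vec image_constant_conv)
  finally have "\<bar>(?G ?z - ?G y) $ i\<bar> \<le> \<delta>" for i
    using component_le_infnorm_cart[of "?G ?z - ?G y" i] by linarith
  then have "?G ?z $ i \<le> ?G y $ i + \<delta>" for i
    using abs_le_D1[of "(?G ?z - ?G y) $ i" \<delta>] by (simp add: algebra_simps)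
  then have "?G ?z \<le> ?G y + vec \<delta>"
    by (simp add: less_eq_vec_def)
  with mono show ?thesis
    by (rule order_trans)
qed

theorem mainTheorem10:
  fixes M :: "('a, 'm::finite) cost_mdp"
    and f :: "real ^ 'm \<Rightarrow> real ^ 'm \<Rightarrow> real ^ 'm"
    and g :: "real \<Rightarrow> real"
    and l :: real
    and bmin bmax :: "real ^ 'm"
    and \<pi> :: "('a, 'm) approx_policy"
  assumes "is_cost_mdp M"
    and "sr_functions (num_states M) f g"
    and "l > 0"
    and "bmin \<le> bmax"
    and "is_approx_policy M l bmin bmax \<pi>"
  shows "\<forall>h\<in>{1..horizon M + 1}. \<forall>s\<in>states M. \<forall>b\<in>budgets l bmin bmax.
    approx_value M f g l bmin bmax \<pi> h s b > -\<infinity> \<longrightarrow>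
    approx_cost M f g \<pi> h s b
      \<le> b + vec (l * (real (num_states M) + 1) * (real (horizon M) - real h + 1))"
proof -
  let ?n = "num_states M"
  let ?\<epsilon> = "l * (real ?n + 1)"
  let ?C = "approx_cost M f g \<pi>" and ?V = "approx_value M f g l bmin bmax \<pi>"
  \<comment> \<open>Backward induction on the stage; \<open>s\<close> and \<open>b\<close> stay
    general because a successor \<open>s'\<close> carries its own budget
    \<open>bs s'\<close>.\<close>
  have "?C h s b \<le> b + vec (?\<epsilon> * (real (horizon M) - real h + 1))"
    if "h \<le> Suc (horizon M)" "1 \<le> h" "s \<in> states M" "?V h s b > -\<infinity>" for h s b
    using that
  proof (induction h arbitrary: s b rule: inc_induct)
    case base
    \<comment> \<open>At the terminal stage the cost and the slack factor are both 0, and a value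
      above -\<infinity> means \<open>b \<ge> 0\<close>.\<close>
    then show ?case
      by (simp add: approx_cost.simps approx_value.simps vec_eq_iff less_eq_vec_def split: if_splits)
  next
    case (step h)
    obtain a bs where \<pi>: "\<pi> h s b = (a, bs)"
      by fastforce
    have h: "h \<le> horizon M"
      using step.hyps by simp
    let ?p = "trans_prob M h s a"
    \<comment> \<open>This is the slack of the induction hypothesis at stage \<open>h + 1\<close>,
      one \<open>?\<epsilon>\<close> less than the slack claimed at \<open>h\<close>.\<close>
    let ?\<delta> = "?\<epsilon> * (real (horizon M) - real h)"
    note succ = approx_value_successor[where \<pi> = \<pi>, OF h \<pi> step.prems(3)]
    have a: "a \<in> actions M h s"
      and budget: "cost M h s a + fhat ?n f g l ?p bs 1 0 \<le> b + vec ?\<epsilon>"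
      using succ(1) by (auto simp: approx_actions_def kappa_def)
    have p: "prob_vector ?n ?p"
      using assms(1) a h step.prems by (auto simp: is_cost_mdp_def)
    have "?C (h + 1) s' (bs s') \<le> bs s' + vec ?\<delta>" if "s' \<in> {1..?n}" "?p s' > 0" for s'
      using step.IH[of s' "bs s'"] succ(2)[of s'] that by (simp add: states_def)
    then have "nest_states f ?n (\<lambda>s'. g (?p s') *\<^sub>R ?C (h + 1) s' (bs s'))
        \<le> nest_states f ?n (\<lambda>s'. g (?p s') *\<^sub>R bs s') + vec ?\<delta>"
      using assms(2,3) p h by (intro nest_states_le_shift) auto
    moreover have "nest_states f ?n (\<lambda>s'. g (?p s') *\<^sub>R bs s') \<le> fhat ?n f g l ?p bs 1 0"
      \<comment> \<open>Starting from accumulator 0, the left unit law removes the outer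
        \<open>f 0\<close>.\<close>
      using nest_le_fhat[of f l 1 ?n 0 g ?p bs] assms(2,3)
      by (auto simp: sr_functions_def nest_states_def)
    ultimately have "cost M h s a + nest_states f ?n (\<lambda>s'. g (?p s') *\<^sub>R ?C (h + 1) s' (bs s'))
        \<le> (cost M h s a + fhat ?n f g l ?p bs 1 0) + vec ?\<delta>"
      by (smt (verit) add.assoc add_left_mono add_right_mono order_trans)
    also have "\<dots> \<le> (b + vec ?\<epsilon>) + vec ?\<delta>"
      using budget by (rule add_right_mono)
    also have "\<dots> = b + vec (?\<epsilon> * (real (horizon M) - real h + 1))"
      by (simp add: vec_eq_iff algebra_simps)
    finally show ?case
      using h \<pi> by (subst approx_cost.simps) simp
  qed
  then show ?thesis
    by simp
qed

end
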